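(* Let $n\ge 4$ and consider $VP_n$ as a subgroup of $VP_{n+1}$ by adding a trivial strand at the end ($\lambda_{ij}\mapsto\lambda_{ij}$). Let $\mathcal{R}^V(n)$ be the set of defining relations $$\lambda_{ij}\lambda_{kl}=\lambda_{kl}\lambda_{ij},\qquad \lambda_{ki}\lambda_{kj}\lambda_{ij}=\lambda_{ij}\lambda_{kj}\lambda_{ki}$$ of $VP_n$ ($1\le i,j,k,l\le n$, distinct letters standing for distinct indices), and for $0\le t\le n-1$ let $s_t(\mathcal{R}^V(n))$ be the set of relations $$s_t(\lambda_{ij})s_t(\lambda_{kl})=s_t(\lambda_{kl})s_t(\lambda_{ij}),\qquad s_t(\lambda_{ki})s_t(\lambda_{kj})s_t(\lambda_{ij})=s_t(\lambda_{ij})s_t(\lambda_{kj})s_t(\lambda_{ki})$$ in the generators of $VP_{n+1}$ obtained by applying the doubling homomorphism $s_t:VP_n\to VP_{n+1}$ to $\mathcal{R}^V(n)$. Then $$\mathcal{R}^V(n)\cup\bigcup_{t=0}^{n-1}s_t(\mathcal{R}^V(n))$$ is a full set of defining relations for $VP_{n+1}$ (on the generators $\lambda_{ij}$, $1\le i\ne j\le n+1$).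
   Context: For $m\ge 2$ the virtual pure braid group $VP_m$ is the group with generators $\lambda_{ij}=\lambda_{i,j}$, $1\le i\ne j\le m$, and relations $\lambda_{ij}\lambda_{kl}=\lambda_{kl}\lambda_{ij}$ and $\lambda_{ki}\lambda_{kj}\lambda_{ij}=\lambda_{ij}\lambda_{kj}\lambda_{ki}$, where distinct letters stand for distinct indices. For $0\le t\le n-1$ the doubling homomorphism $s_t:VP_n\to VP_{n+1}$ (doubling the $(t+1)$-st strand) is given on generators, for $1\le k<l\le n$ and with $y^x=x^{-1}yx$, by the following words, which are the words used in writing the relations $s_t(\mathcal{R}^V(n))$: - $s_t(\lambda_{k,l})=\lambda_{k+1,l+1}$ if $t<k-1$; $\lambda_{k,l+1}\lambda_{k+1,l+1}$ if $t=k-1$; $\lambda_{k,l+1}$ if $k-1<t<l-1$; $\lambda_{k,l+1}^{\lambda_{1,l}\lambda_{2,l}\cdots\lambda_{k-1,l}}\lambda_{k,l}$ if $t=l-1$; $\lambda_{k,l}$ if $t>l-1$. - $s_t(\lambda_{l,k})=\lambda_{l+1,k+1}$ if $t<k-1$; $\lambda_{l+1,k+1}\lambda_{l+1,k}$ if $t=k-1$; $\lambda_{l+1,k}$ if $k-1<t<l-1$; $\lambda_{l,k}\lambda_{l+1,k}^{\lambda_{l,1}^{-1}\lambda_{l,2}^{-1}\cdots\lambda_{l,k-1}^{-1}}$ if $t=l-1$; $\lambda_{l,k}$ if $t>l-1$. *)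

theory Defs
  imports "HOL-Algebra.Group"
begin

text \<open>A group word is a list of letters, where \<open>(x, True)\<close> stands for the generator \<open>x\<close> and
  \<open>(x, False)\<close> for its formal inverse. Words are not required to be reduced; a relation \<open>u = v\<close>
  between words is the pair \<open>(u, v)\<close>.\<close>

type_synonym 'a gword = "('a \<times> bool) list"

definition gwords :: "'a set \<Rightarrow> 'a gword set" where
  "gwords X = lists (X \<times> UNIV)"

definition gword_inv :: "'a gword \<Rightarrow> 'a gword" where
  "gword_inv w = rev (map (\<lambda>(x, b). (x, \<not> b)) w)"

text \<open>The congruence on words over \<open>X\<close> generated by free cancellation and the relations \<open>R\<close>.\<close>

inductive_set pres_cong :: "'a set \<Rightarrow> ('a gword \<times> 'a gword) set \<Rightarrow> ('a gword \<times> 'a gword) set"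
  for X :: "'a set" and R :: "('a gword \<times> 'a gword) set"
  where
    rel: "(u, v) \<in> R \<Longrightarrow> u \<in> gwords X \<Longrightarrow> v \<in> gwords X \<Longrightarrow> (u, v) \<in> pres_cong X R"
  | cancel: "x \<in> X \<Longrightarrow> ([(x, b), (x, \<not> b)], []) \<in> pres_cong X R"
  | refl: "u \<in> gwords X \<Longrightarrow> (u, u) \<in> pres_cong X R"
  | sym: "(u, v) \<in> pres_cong X R \<Longrightarrow> (v, u) \<in> pres_cong X R"
  | trans: "(u, v) \<in> pres_cong X R \<Longrightarrow> (v, w) \<in> pres_cong X R \<Longrightarrow> (u, w) \<in> pres_cong X R"
  | append: "(u, v) \<in> pres_cong X R \<Longrightarrow> (u', v') \<in> pres_cong X R \<Longrightarrow>
      (u @ u', v @ v') \<in> pres_cong X R"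

definition pres_class :: "'a set \<Rightarrow> ('a gword \<times> 'a gword) set \<Rightarrow> 'a gword \<Rightarrow> 'a gword set" where
  "pres_class X R w = pres_cong X R `` {w}"

definition presented_group :: "'a set \<Rightarrow> ('a gword \<times> 'a gword) set \<Rightarrow> 'a gword set monoid" where
  "presented_group X R =
    \<lparr> carrier = gwords X // pres_cong X R,
      mult = (\<lambda>A B. pres_cong X R `` {u @ v | u v. u \<in> A \<and> v \<in> B}),
      one = pres_class X R [] \<rparr>"

text \<open>\<open>R\<close> is a full set of defining relations for the group \<open>G\<close> on the generators \<open>\<iota> x\<close>
  (\<open>x \<in> X\<close>): mapping each \<open>x\<close> to \<open>\<iota> x\<close> gives an isomorphism from the group presented by
  \<open>X\<close> and \<open>R\<close> onto \<open>G\<close>.\<close>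

definition full_defining_relations ::
    "('g, 'm) monoid_scheme \<Rightarrow> 'a set \<Rightarrow> ('a \<Rightarrow> 'g) \<Rightarrow> ('a gword \<times> 'a gword) set \<Rightarrow> bool" where
  "full_defining_relations G X \<iota> R \<longleftrightarrow>
    R \<subseteq> gwords X \<times> gwords X \<and>
    (\<exists>\<phi> \<in> iso (presented_group X R) G. \<forall>x\<in>X. \<phi> (pres_class X R [(x, True)]) = \<iota> x)"

lemma pres_cong_gwords:
  "(u, v) \<in> pres_cong X R \<Longrightarrow> u \<in> gwords X \<and> v \<in> gwords X"
  by (induction rule: pres_cong.induct) (auto simp: gwords_def)

lemma equiv_pres_cong: "equiv (gwords X) (pres_cong X R)"
  by (rule equivI)
    (auto simp: refl_on_def sym_def trans_def
      intro: pres_cong.refl pres_cong.sym pres_cong.trans dest: pres_cong_gwords)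

lemma pres_class_mult:
  assumes "u \<in> gwords X" "v \<in> gwords X"
  shows "pres_class X R u \<otimes>\<^bsub>presented_group X R\<^esub> pres_class X R v = pres_class X R (u @ v)"
proof -
  have "pres_cong X R `` {u' @ v' | u' v'. (u, u') \<in> pres_cong X R \<and> (v, v') \<in> pres_cong X R}
      = pres_cong X R `` {u @ v}"
    using assms by (blast intro: pres_cong.refl pres_cong.trans pres_cong.append)
  then show ?thesis
    by (simp add: presented_group_def pres_class_def)
qed

lemma gword_inv_cancel:
  "w \<in> gwords X \<Longrightarrow> (gword_inv w @ w, []) \<in> pres_cong X R"
proof (induction w)
  case Nil
  then show ?case by (simp add: gword_inv_def pres_cong.refl)
next
  case (Cons a w)
  obtain x b where a: "a = (x, b)" by (cases a)
  have x: "x \<in> X" and w: "w \<in> gwords X" using Cons.prems a by (auto simp: gwords_def)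
  have iw: "gword_inv w \<in> gwords X" using pres_cong_gwords[OF Cons.IH[OF w]] by (simp add: gwords_def)
  have "([(x, \<not> b), (x, \<not> \<not> b)] @ w, [] @ w) \<in> pres_cong X R"
    by (intro pres_cong.append pres_cong.cancel pres_cong.refl x w)
  then have "(gword_inv w @ ([(x, \<not> b), (x, b)] @ w), gword_inv w @ w) \<in> pres_cong X R"
    using pres_cong.append[OF pres_cong.refl[OF iw]] by fastforce
  then show ?case
    using Cons.IH[OF w] pres_cong.trans by (fastforce simp: gword_inv_def a)
qed

lemma group_presented_group: "group (presented_group X R)"
proof (rule groupI)
  let ?G = "presented_group X R"
  have carr: "A \<in> carrier ?G \<longleftrightarrow> (\<exists>u\<in>gwords X. A = pres_class X R u)" for A
    by (auto simp: presented_group_def pres_class_def quotient_def)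
  have one: "\<one>\<^bsub>?G\<^esub> = pres_class X R []" by (simp add: presented_group_def)
  have nil: "[] \<in> gwords X" by (simp add: gwords_def)
  have app: "u @ v \<in> gwords X" if "u \<in> gwords X" "v \<in> gwords X" for u v
    using that by (simp add: gwords_def)
  show "A \<otimes>\<^bsub>?G\<^esub> B \<in> carrier ?G" if "A \<in> carrier ?G" "B \<in> carrier ?G" for A B
    using that app by (auto simp: carr pres_class_mult)
  show "\<one>\<^bsub>?G\<^esub> \<in> carrier ?G" using nil by (auto simp: carr one)
  show "A \<otimes>\<^bsub>?G\<^esub> B \<otimes>\<^bsub>?G\<^esub> C = A \<otimes>\<^bsub>?G\<^esub> (B \<otimes>\<^bsub>?G\<^esub> C)"
    if "A \<in> carrier ?G" "B \<in> carrier ?G" "C \<in> carrier ?G" for A B C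
    using that by (auto simp: carr pres_class_mult app)
  show "\<one>\<^bsub>?G\<^esub> \<otimes>\<^bsub>?G\<^esub> A = A" if "A \<in> carrier ?G" for A
    using that nil by (auto simp: carr one pres_class_mult)
  show "\<exists>B\<in>carrier ?G. B \<otimes>\<^bsub>?G\<^esub> A = \<one>\<^bsub>?G\<^esub>" if A: "A \<in> carrier ?G" for A
  proof -
    obtain u where u: "u \<in> gwords X" "A = pres_class X R u" using A carr by auto
    have c: "(gword_inv u @ u, []) \<in> pres_cong X R" by (rule gword_inv_cancel[OF u(1)])
    have iu: "gword_inv u \<in> gwords X" using pres_cong_gwords[OF c] by (simp add: gwords_def)
    have "pres_class X R (gword_inv u @ u) = pres_class X R []"
      unfolding pres_class_def by (rule equiv_class_eq[OF equiv_pres_cong c])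
    then show ?thesis
      using u iu by (intro bexI[of _ "pres_class X R (gword_inv u)"]) (auto simp: carr one pres_class_mult)
  qed
qed

definition lam :: "nat \<Rightarrow> nat \<Rightarrow> (nat \<times> nat) gword" where
  "lam i j = [((i, j), True)]"

definition VP_gens :: "nat \<Rightarrow> (nat \<times> nat) set" where
  "VP_gens m = {(i, j). 1 \<le> i \<and> i \<le> m \<and> 1 \<le> j \<and> j \<le> m \<and> i \<noteq> j}"

definition VP_rels :: "nat \<Rightarrow> ((nat \<times> nat) gword \<times> (nat \<times> nat) gword) set" where
  "VP_rels m =
    {(lam i j @ lam k l, lam k l @ lam i j) | i j k l.
        {i, j, k, l} \<subseteq> {1..m} \<and> distinct [i, j, k, l]} \<union>
    {(lam k i @ lam k j @ lam i j, lam i j @ lam k j @ lam k i) | i j k.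
        {i, j, k} \<subseteq> {1..m} \<and> distinct [i, j, k]}"

definition VP :: "nat \<Rightarrow> (nat \<times> nat) gword set monoid" where
  "VP m = presented_group (VP_gens m) (VP_rels m)"

definition VP_gen :: "nat \<Rightarrow> nat \<times> nat \<Rightarrow> (nat \<times> nat) gword set" where
  "VP_gen m g = pres_class (VP_gens m) (VP_rels m) [(g, True)]"

definition gword_conj :: "'a gword \<Rightarrow> 'a gword \<Rightarrow> 'a gword" where
  "gword_conj y x = gword_inv x @ y @ x"

text \<open>For \<open>1 \<le> k < l\<close>, \<open>doubling_pos t k l\<close> and \<open>doubling_neg t k l\<close> are the words
  \<open>s\<^sub>t(\<lambda>\<^bsub>k,l\<^esub>)\<close> and \<open>s\<^sub>t(\<lambda>\<^bsub>l,k\<^esub>)\<close>; note the order of the arguments in the latter.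
  Since \<open>k, l \<ge> 1\<close>, the subtractions do not truncate.\<close>

definition doubling_pos :: "nat \<Rightarrow> nat \<Rightarrow> nat \<Rightarrow> (nat \<times> nat) gword" where
  "doubling_pos t k l =
    (if t < k - 1 then lam (k+1) (l+1)
     else if t = k - 1 then lam k (l+1) @ lam (k+1) (l+1)
     else if t < l - 1 then lam k (l+1)
     else if t = l - 1 then
       gword_conj (lam k (l+1)) (concat (map (\<lambda>i. lam i l) [1..<k])) @ lam k l
     else lam k l)"

definition doubling_neg :: "nat \<Rightarrow> nat \<Rightarrow> nat \<Rightarrow> (nat \<times> nat) gword" where
  "doubling_neg t k l =
    (if t < k - 1 then lam (l+1) (k+1)
     else if t = k - 1 then lam (l+1) (k+1) @ lam (l+1) k
     else if t < l - 1 then lam (l+1) k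
     else if t = l - 1 then
       lam l k @ gword_conj (lam (l+1) k) (concat (map (\<lambda>i. gword_inv (lam l i)) [1..<k]))
     else lam l k)"

definition doubling_gen :: "nat \<Rightarrow> nat \<times> nat \<Rightarrow> (nat \<times> nat) gword" where
  "doubling_gen t = (\<lambda>(i, j). if i < j then doubling_pos t i j else doubling_neg t j i)"

definition gword_subst :: "('a \<Rightarrow> 'b gword) \<Rightarrow> 'a gword \<Rightarrow> 'b gword" where
  "gword_subst f w = concat (map (\<lambda>(x, b). if b then f x else gword_inv (f x)) w)"

definition doubling :: "nat \<Rightarrow> (nat \<times> nat) gword \<Rightarrow> (nat \<times> nat) gword" where
  "doubling t = gword_subst (doubling_gen t)"

definition doubled_rels :: "nat \<Rightarrow> nat \<Rightarrow> ((nat \<times> nat) gword \<times> (nat \<times> nat) gword) set" where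
  "doubled_rels t n = (\<lambda>(u, v). (doubling t u, doubling t v)) ` VP_rels n"

end

theory Submission
  imports Defs
begin

text \<open>Two sets of relations on the same generators present the same group as soon as each holds in
  the group presented by the other, and whether a set of relations holds can be decided on the
  values \<open>x (i, j)\<close> of the generators \<open>\<lambda>\<^bsub>i,j\<^esub>\<close>. So let \<open>x\<close> be any such family of elements of a
  group, and let \<open>dbl p i j\<close> be the value of the doubled generator \<open>s\<^bsub>p-1\<^esub>(\<lambda>\<^bsub>i,j\<^esub>)\<close>, in which the
  strand \<open>p\<close> is replaced by the two parallel strands \<open>p\<close> and \<open>p+1\<close>. Up to the conjugation that
  occurs when the doubled strand is the higher one, \<open>dbl p i j\<close> is a generator if
  \<open>p \<notin> {i, j}\<close> and otherwise a product of two generators, one for \<open>p\<close> and one for \<open>p+1\<close>.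

  The doubled relations hold in \<open>VP\<^bsub>n+1\<^esub>\<close>: there the conjugating words commute with the letter they
  conjugate, and a product of two solutions of the Yang--Baxter equation is again a solution when the
  factors that have to pass each other have disjoint indices (\<open>comm_family_dbl\<close>, \<open>yb_family_dbl\<close>).

  For the converse, a relation for a doubled strand says: if the relation of \<open>VP\<^bsub>n+1\<^esub>\<close> holds for one
  of the strands \<open>p\<close> and \<open>p+1\<close>, it holds for the other. Starting from the relations among the first
  \<open>n\<close> strands, one slides indices upwards, \<open>p\<close> to \<open>p+1\<close>, until every relation that involves the
  strand \<open>n+1\<close> is reached. The commutation relations come first, and among them those of
  \<open>x (a, n+1)\<close> with \<open>x (k, l)\<close>, by induction on \<open>a\<close>. They are the delicate part because doubling the
  last strand \<open>n\<close> brings in \<open>x (a, n+1)\<close> only as its conjugate by \<open>x (1, n) \<cdots> x (a-1, n)\<close>, and the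
  conjugation may be dropped only once \<open>x (a, n+1)\<close> is known to commute with these. For \<open>a = 1\<close> the
  conjugating word is empty (\<open>comm_top_first\<close>); for \<open>a = 2\<close> it is the single letter \<open>x (1, n)\<close>,
  and a relation from doubling the strand \<open>n-1\<close> removes it (\<open>comm_top_second\<close>); for \<open>a \<ge> 3\<close>
  nearly everything follows by sliding from \<open>a-1\<close> to \<open>a\<close> (\<open>comm_top_all\<close>).

  The letters \<open>\<lambda>\<^bsub>n+1,a\<^esub>\<close> are covered by symmetry: reading words backwards and exchanging the two
  indices of each letter preserves both the defining and the doubled relations
  (\<open>mirror_doubled_rels\<close>). Once all commutation relations hold, all doubled generators are plain
  products, and the Yang--Baxter relations follow by sliding (\<open>yb_family_all\<close>).\<close>

section \<open>Presentations with the same congruence\<close>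

lemma gwords_append [simp]: "u @ v \<in> gwords X \<longleftrightarrow> u \<in> gwords X \<and> v \<in> gwords X"
  by (auto simp: gwords_def)

lemma gwords_Nil [simp]: "[] \<in> gwords X"
  by (simp add: gwords_def)

lemma gwords_Cons [simp]: "(x, b) # w \<in> gwords X \<longleftrightarrow> x \<in> X \<and> w \<in> gwords X"
  by (auto simp: gwords_def)

lemma gword_inv_append: "gword_inv (u @ v) = gword_inv v @ gword_inv u"
  by (simp add: gword_inv_def)

lemma gword_inv_gword_inv [simp]: "gword_inv (gword_inv w) = w"
  by (simp add: gword_inv_def rev_map o_def case_prod_unfold)

lemma gword_inv_in_gwords [simp]: "gword_inv w \<in> gwords X \<longleftrightarrow> w \<in> gwords X"
  by (auto simp: gword_inv_def gwords_def lists_eq_set)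

lemma pres_cong_subset:
  assumes "\<And>u v. (u, v) \<in> R \<Longrightarrow> (u, v) \<in> pres_cong X R'"
  shows "pres_cong X R \<subseteq> pres_cong X R'"
proof (rule subrelI)
  show "(u, v) \<in> pres_cong X R'" if "(u, v) \<in> pres_cong X R" for u v
    using that by induction (auto intro: assms pres_cong.intros)
qed

lemma rels_subset_pres_cong: "R \<subseteq> gwords X \<times> gwords X \<Longrightarrow> R \<subseteq> pres_cong X R"
  by (auto intro: pres_cong.rel)

lemma full_defining_relations_presented_group:
  assumes R': "R' \<subseteq> pres_cong X R" and R: "R \<subseteq> pres_cong X R'"
  shows "full_defining_relations (presented_group X R) X
           (\<lambda>x. pres_class X R [(x, True)]) R'"
proof -
  have eq: "pres_cong X R' = pres_cong X R"
    using R R' by (intro subset_antisym pres_cong_subset) auto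
  have "R' \<subseteq> gwords X \<times> gwords X"
    using R' by (auto dest: pres_cong_gwords)
  moreover have "presented_group X R' = presented_group X R"
    by (simp add: presented_group_def pres_class_def eq)
  moreover have "pres_class X R' = pres_class X R"
    by (simp add: pres_class_def fun_eq_iff eq)
  moreover have "id \<in> iso (presented_group X R) (presented_group X R)"
    by (simp add: iso_def hom_def id_def bij_betw_def)
  ultimately show ?thesis
    unfolding full_defining_relations_def by (metis id_apply)
qed

lemma pres_class_eq_iff:
  assumes "u \<in> gwords X" "v \<in> gwords X"
  shows "pres_class X R u = pres_class X R v \<longleftrightarrow> (u, v) \<in> pres_cong X R"
  unfolding pres_class_def by (rule eq_equiv_class_iff[OF equiv_pres_cong assms])

section \<open>The defining relations\<close>

lemma VP_rels_comm:
  assumes "{i, j, k, l} \<subseteq> {1..n}" "distinct [i, j, k, l]"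
  shows "(lam i j @ lam k l, lam k l @ lam i j) \<in> VP_rels n"
  using assms unfolding VP_rels_def by blast

lemma VP_rels_yang_baxter:
  assumes "{i, j, k} \<subseteq> {1..n}" "distinct [i, j, k]"
  shows "(lam k i @ lam k j @ lam i j, lam i j @ lam k j @ lam k i) \<in> VP_rels n"
  using assms unfolding VP_rels_def by blast

lemma VP_rels_cases:
  assumes "(u, v) \<in> VP_rels n"
  obtains (comm) i j k l where "u = lam i j @ lam k l" "v = lam k l @ lam i j"
      "{i, j, k, l} \<subseteq> {1..n}" "distinct [i, j, k, l]"
    | (yb) i j k where "u = lam k i @ lam k j @ lam i j" "v = lam i j @ lam k j @ lam k i"
      "{i, j, k} \<subseteq> {1..n}" "distinct [i, j, k]"
  using assms unfolding VP_rels_def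
  by (elim UnE CollectE exE conjE Pair_inject) (erule (3) that(1), erule (3) that(2))

section \<open>Values of words in a group\<close>

locale word_values = group G for G (structure) +
  fixes x :: "'b \<Rightarrow> 'a"
  assumes x_closed [simp]: "x g \<in> carrier G"
begin

primrec ev :: "'b gword \<Rightarrow> 'a" where
  "ev [] = \<one>"
| "ev (a # w) = (if snd a then x (fst a) else inv x (fst a)) \<otimes> ev w"

lemma ev_closed [simp]: "ev w \<in> carrier G"
  by (induction w) auto

lemma ev_append [simp]: "ev (u @ v) = ev u \<otimes> ev v"
  by (induction u) (auto simp: m_assoc)

lemma ev_gword_inv [simp]: "ev (gword_inv w) = inv ev w"
proof (induction w)
  case (Cons a w)
  have "gword_inv (a # w) = gword_inv w @ [(fst a, \<not> snd a)]"
    by (simp add: gword_inv_def case_prod_unfold)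
  then show ?case
    using Cons by (simp add: inv_mult_group)
qed (simp add: gword_inv_def)

lemma ev_gword_conj: "ev (gword_conj y w) = inv ev w \<otimes> ev y \<otimes> ev w"
  by (simp add: gword_conj_def m_assoc)

end

text \<open>The classes of the generators, extended to all letters by the unit so that every letter has a
  value in the group.\<close>

definition gen_value :: "'a set \<Rightarrow> ('a gword \<times> 'a gword) set \<Rightarrow> 'a \<Rightarrow> 'a gword set" where
  "gen_value X R g = (if g \<in> X then pres_class X R [(g, True)] else \<one>\<^bsub>presented_group X R\<^esub>)"

lemma word_values_presented_group:
  "word_values (presented_group X R)
     (gen_value X R)"
proof -
  interpret group "presented_group X R" by (rule group_presented_group)
  show ?thesis
    by standard (auto simp: gen_value_def presented_group_def pres_class_def intro: quotientI)
qed

lemma ev_presented_group: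
  assumes "w \<in> gwords X"
  shows "word_values.ev (presented_group X R)
     (gen_value X R) w
     = pres_class X R w"
proof -
  interpret word_values "presented_group X R"
    "gen_value X R"
    by (rule word_values_presented_group)
  have one: "\<one>\<^bsub>presented_group X R\<^esub> = pres_class X R []"
    by (simp add: presented_group_def)
  have closed: "pres_class X R w \<in> carrier (presented_group X R)" if "w \<in> gwords X" for w
    using that by (simp add: presented_group_def pres_class_def quotientI)
  show ?thesis
    using assms
  proof (induction w)
    case Nil
    then show ?case by (simp add: one)
  next
    case (Cons a w)
    obtain g b where a: "a = (g, b)" by (cases a)
    have g: "g \<in> X" and w: "w \<in> gwords X" using Cons.prems by (auto simp: a)
    have "([(g, False), (g, True)], []) \<in> pres_cong X R"
      using pres_cong.cancel[OF g, of False] by simp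
    then have "pres_class X R [(g, False)] \<otimes>\<^bsub>presented_group X R\<^esub> pres_class X R [(g, True)]
        = \<one>\<^bsub>presented_group X R\<^esub>"
      using g by (simp add: pres_class_mult one pres_class_eq_iff)
    then have "inv\<^bsub>presented_group X R\<^esub> pres_class X R [(g, True)] = pres_class X R [(g, False)]"
      using g by (intro inv_equality closed) auto
    moreover have "gen_value X R g = pres_class X R [(g, True)]"
      using g by (simp add: gen_value_def)
    ultimately show ?case
      using g w Cons.IH pres_class_mult[of "[(g, b)]" X w R]
      by (cases b) (simp_all add: a)
  qed
qed

text \<open>This turns questions about the congruence on words into computations with group elements.\<close>

lemma presented_group_holds_iff:
  assumes S: "S \<subseteq> gwords X \<times> gwords X"
  shows "(\<forall>(u, v) \<in> S. word_values.ev (presented_group X R)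
       (gen_value X R) u
     = word_values.ev (presented_group X R)
       (gen_value X R) v)
     \<longleftrightarrow> S \<subseteq> pres_cong X R"
proof -
  have "word_values.ev (presented_group X R)
       (gen_value X R) u
     = word_values.ev (presented_group X R)
       (gen_value X R) v
     \<longleftrightarrow> (u, v) \<in> pres_cong X R" if "(u, v) \<in> S" for u v
  proof -
    have "u \<in> gwords X" "v \<in> gwords X" using that S by auto
    then show ?thesis by (simp add: ev_presented_group pres_class_eq_iff)
  qed
  then show ?thesis by fast
qed

section \<open>Commuting elements and the Yang--Baxter relation\<close>

context group
begin

definition commutes :: "'a \<Rightarrow> 'a \<Rightarrow> bool" where
  "commutes a b \<longleftrightarrow> a \<otimes> b = b \<otimes> a"

lemma commutes_sym: "commutes a b \<Longrightarrow> commutes b a"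
  by (simp add: commutes_def)

lemma commutes_left:
  assumes "commutes a b" "a \<in> carrier G" "b \<in> carrier G" "c \<in> carrier G"
  shows "a \<otimes> (b \<otimes> c) = b \<otimes> (a \<otimes> c)"
  using assms by (metis commutes_def m_assoc)

lemma commutes_mult:
  assumes "commutes y a" "commutes y b" and [simp]: "y \<in> carrier G" "a \<in> carrier G" "b \<in> carrier G"
  shows "commutes y (a \<otimes> b)"
  using assms(2) by (simp add: commutes_def m_assoc commutes_left[OF assms(1)])

lemma commutes_mult_left_iff:
  assumes "commutes y a" and [simp]: "y \<in> carrier G" "a \<in> carrier G" "b \<in> carrier G"
  shows "commutes y (a \<otimes> b) \<longleftrightarrow> commutes y b"
proof -
  have "commutes y (a \<otimes> b) \<longleftrightarrow> a \<otimes> (y \<otimes> b) = a \<otimes> (b \<otimes> y)"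
    by (simp add: commutes_def commutes_left[OF assms(1)] m_assoc)
  then show ?thesis by (simp add: commutes_def)
qed

lemma commutes_mult_right_iff:
  assumes "commutes y b" and [simp]: "y \<in> carrier G" "a \<in> carrier G" "b \<in> carrier G"
  shows "commutes y (a \<otimes> b) \<longleftrightarrow> commutes y a"
proof -
  have "commutes y (a \<otimes> b) \<longleftrightarrow> (y \<otimes> a) \<otimes> b = (a \<otimes> y) \<otimes> b"
    using assms(1) by (simp add: commutes_def m_assoc)
  then show ?thesis by (simp add: commutes_def)
qed

lemma commutes_factors_iff:
  assumes "commutes y (a \<otimes> b)" and "y \<in> carrier G" "a \<in> carrier G" "b \<in> carrier G"
  shows "commutes y a \<longleftrightarrow> commutes y b"
  using assms commutes_mult_left_iff commutes_mult_right_iff by blast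

lemma commutes_inv:
  assumes "commutes y a" and [simp]: "y \<in> carrier G" "a \<in> carrier G"
  shows "commutes y (inv a)"
  using commutes_mult_left_iff[OF assms(1), of "inv a"] by (simp add: commutes_def)

lemma inv_mult_cancel_left: "a \<in> carrier G \<Longrightarrow> b \<in> carrier G \<Longrightarrow> inv a \<otimes> (a \<otimes> b) = b"
  by (simp add: m_assoc[symmetric])

lemma commutes_conj:
  assumes "commutes y a" and [simp]: "y \<in> carrier G" "a \<in> carrier G"
  shows "inv a \<otimes> y \<otimes> a = y"
  using assms(1) by (simp add: commutes_def inv_mult_cancel_left m_assoc)

text \<open>The hypothesis says that \<open>b\<^sup>a = b\<^bsup>inv c\<^esup>\<close>, since \<open>b\<close> commutes with \<open>a \<otimes> c\<close>; and an
  element commutes with \<open>c\<close> as soon as its conjugate by \<open>inv c\<close> does.\<close>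

lemma commutes_of_conj:
  assumes "commutes b (a \<otimes> c)" and "commutes (inv a \<otimes> b \<otimes> a) c"
    and [simp]: "a \<in> carrier G" "b \<in> carrier G" "c \<in> carrier G"
  shows "commutes b c"
proof -
  have "inv a \<otimes> (b \<otimes> (a \<otimes> c)) = c \<otimes> b"
    using assms(1) by (simp add: commutes_def m_assoc inv_mult_cancel_left)
  then have "c \<otimes> (inv a \<otimes> (b \<otimes> a)) = c \<otimes> b"
    using assms(2) by (simp add: commutes_def m_assoc)
  then have "inv a \<otimes> (b \<otimes> a) = b" by simp
  then have *: "inv a \<otimes> b \<otimes> a = b" by (simp add: m_assoc)
  show ?thesis using assms(2) unfolding * .
qed

text \<open>The element \<open>rij\<close> belongs to the strands \<open>i\<close> and \<open>j\<close>. In the following three lemmas one of the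
  three strands is doubled: \<open>s\<close> carries the elements of its second copy. The elements required to
  commute belong to disjoint pairs of strands, and moving them past each other splits the equation
  for the products into the equations for \<open>r\<close> and for \<open>s\<close>. As the former is assumed, the equation
  for the products is equivalent to the latter, which can be read in either direction.\<close>

definition yang_baxter :: "'a \<Rightarrow> 'a \<Rightarrow> 'a \<Rightarrow> bool" where
  "yang_baxter r12 r13 r23 \<longleftrightarrow> r12 \<otimes> (r13 \<otimes> r23) = r23 \<otimes> (r13 \<otimes> r12)"

lemma yang_baxter_double_first:
  assumes Y: "yang_baxter r12 r13 r23" and c: "commutes s12 r13" "commutes r12 s13"
    and [simp]: "r12 \<in> carrier G" "r13 \<in> carrier G" "r23 \<in> carrier G" "s12 \<in> carrier G" "s13 \<in> carrier G"
  shows "yang_baxter (r12 \<otimes> s12) (r13 \<otimes> s13) r23 \<longleftrightarrow> yang_baxter s12 s13 r23"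
proof -
  have "(r12 \<otimes> s12) \<otimes> ((r13 \<otimes> s13) \<otimes> r23) = r12 \<otimes> (r13 \<otimes> (s12 \<otimes> (s13 \<otimes> r23)))"
    by (simp add: m_assoc commutes_left[OF c(1)])
  moreover have "r23 \<otimes> ((r13 \<otimes> s13) \<otimes> (r12 \<otimes> s12)) = r23 \<otimes> (r13 \<otimes> r12) \<otimes> (s13 \<otimes> s12)"
    using c(2) by (simp add: m_assoc commutes_left[OF commutes_sym[OF c(2)]])
  moreover have "\<dots> = r12 \<otimes> (r13 \<otimes> (r23 \<otimes> (s13 \<otimes> s12)))"
    using Y unfolding yang_baxter_def by (metis assms(4-8) m_assoc m_closed)
  ultimately show ?thesis
    by (simp add: yang_baxter_def)
qed

lemma yang_baxter_double_second:
  assumes Y: "yang_baxter r12 r13 r23" and c: "commutes s12 r23" "commutes s23 r12"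
    and [simp]: "r12 \<in> carrier G" "r13 \<in> carrier G" "r23 \<in> carrier G" "s12 \<in> carrier G" "s23 \<in> carrier G"
  shows "yang_baxter (s12 \<otimes> r12) r13 (r23 \<otimes> s23) \<longleftrightarrow> yang_baxter s12 r13 s23"
proof -
  have "(s12 \<otimes> r12) \<otimes> (r13 \<otimes> (r23 \<otimes> s23)) = s12 \<otimes> (r12 \<otimes> (r13 \<otimes> r23)) \<otimes> s23"
    by (simp add: m_assoc)
  also have "\<dots> = s12 \<otimes> (r23 \<otimes> (r13 \<otimes> (r12 \<otimes> s23)))"
    using Y unfolding yang_baxter_def by (simp add: m_assoc)
  also have "\<dots> = r23 \<otimes> (s12 \<otimes> (r13 \<otimes> (s23 \<otimes> r12)))"
    using c(2) by (simp add: commutes_left[OF c(1)] commutes_def)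
  finally have "(s12 \<otimes> r12) \<otimes> (r13 \<otimes> (r23 \<otimes> s23)) = r23 \<otimes> ((s12 \<otimes> (r13 \<otimes> s23)) \<otimes> r12)"
    by (simp add: m_assoc)
  moreover have "(r23 \<otimes> s23) \<otimes> (r13 \<otimes> (s12 \<otimes> r12)) = r23 \<otimes> ((s23 \<otimes> (r13 \<otimes> s12)) \<otimes> r12)"
    by (simp add: m_assoc)
  ultimately show ?thesis
    by (simp add: yang_baxter_def)
qed

lemma yang_baxter_double_third:
  assumes Y: "yang_baxter r12 r13 r23" and c: "commutes r13 s23" "commutes r23 s13"
    and [simp]: "r12 \<in> carrier G" "r13 \<in> carrier G" "r23 \<in> carrier G" "s13 \<in> carrier G" "s23 \<in> carrier G"
  shows "yang_baxter r12 (s13 \<otimes> r13) (s23 \<otimes> r23) \<longleftrightarrow> yang_baxter r12 s13 s23"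
proof -
  have "r12 \<otimes> ((s13 \<otimes> r13) \<otimes> (s23 \<otimes> r23)) = (r12 \<otimes> (s13 \<otimes> s23)) \<otimes> (r13 \<otimes> r23)"
    by (simp add: m_assoc commutes_left[OF c(1)])
  moreover have "(s23 \<otimes> r23) \<otimes> ((s13 \<otimes> r13) \<otimes> r12) = s23 \<otimes> (s13 \<otimes> (r23 \<otimes> (r13 \<otimes> r12)))"
    by (simp add: m_assoc commutes_left[OF c(2)])
  moreover have "\<dots> = (s23 \<otimes> (s13 \<otimes> r12)) \<otimes> (r13 \<otimes> r23)"
    using Y unfolding yang_baxter_def by (metis assms(4-8) m_assoc m_closed)
  ultimately show ?thesis
    by (simp add: yang_baxter_def)
qed

end


section \<open>Doubled generators as group elements\<close>

text \<open>The new number of a strand \<open>i \<noteq> p\<close> after the strand \<open>p\<close> has been doubled into \<open>p\<close> and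
  \<open>p + 1\<close>.\<close>

definition shift :: "nat \<Rightarrow> nat \<Rightarrow> nat" where
  "shift p i = (if i < p then i else i + 1)"

lemma shift_inject [simp]: "shift p i = shift p j \<longleftrightarrow> i = j"
  by (auto simp: shift_def)

lemma shift_neq [simp]:
  "i \<noteq> p \<Longrightarrow> shift p i \<noteq> p" "i \<noteq> p \<Longrightarrow> p \<noteq> shift p i"
  "shift p i = Suc p \<longleftrightarrow> i = p" "Suc p = shift p i \<longleftrightarrow> i = p"
  by (auto simp: shift_def)

lemma shift_range: "i \<in> {1..n} \<Longrightarrow> shift p i \<in> {1..n + 1}"
  by (auto simp: shift_def)

lemma shift_surj:
  assumes "r \<in> {1..n + 1}" "r \<notin> {p, p + 1}" "p \<in> {1..n}"
  obtains q where "q \<in> {1..n}" "q \<noteq> p" "r = shift p q"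
proof
  show "(if r < p then r else r - 1) \<in> {1..n}"
    and "(if r < p then r else r - 1) \<noteq> p"
    and "r = shift p (if r < p then r else r - 1)"
    using assms by (auto simp: shift_def)
qed

locale strand_values = word_values G x for G (structure) and x :: "nat \<times> nat \<Rightarrow> 'a"
begin

text \<open>Indexed by the doubled strand \<open>p\<close>, counted from 1 as the strands are, whereas the index of the
  doubling homomorphisms starts at 0.\<close>

definition dbl :: "nat \<Rightarrow> nat \<Rightarrow> nat \<Rightarrow> 'a" where
  "dbl p i j = ev (doubling_gen (p - 1) (i, j))"

definition comm_family :: "nat \<Rightarrow> (nat \<Rightarrow> nat \<Rightarrow> 'a) \<Rightarrow> bool" where
  "comm_family n f \<longleftrightarrow> (\<forall>i j k l. {i, j, k, l} \<subseteq> {1..n} \<longrightarrow> distinct [i, j, k, l] \<longrightarrow>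
     commutes (f i j) (f k l))"

definition yb_family :: "nat \<Rightarrow> (nat \<Rightarrow> nat \<Rightarrow> 'a) \<Rightarrow> bool" where
  "yb_family n f \<longleftrightarrow> (\<forall>i j k. {i, j, k} \<subseteq> {1..n} \<longrightarrow> distinct [i, j, k] \<longrightarrow>
     yang_baxter (f i j) (f i k) (f j k))"

lemma comm_familyD:
  "comm_family n f \<Longrightarrow> {i, j, k, l} \<subseteq> {1..n} \<Longrightarrow> distinct [i, j, k, l] \<Longrightarrow> commutes (f i j) (f k l)"
  by (auto simp: comm_family_def)

lemma yb_familyD:
  "yb_family n f \<Longrightarrow> {i, j, k} \<subseteq> {1..n} \<Longrightarrow> distinct [i, j, k] \<Longrightarrow>
   yang_baxter (f i j) (f i k) (f j k)"
  by (auto simp: yb_family_def)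

lemma ev_lam [simp]: "ev (lam i j) = x (i, j)"
  by (simp add: lam_def)

lemma VP_rels_hold_iff:
  "(\<forall>(u, v) \<in> VP_rels n. ev u = ev v) \<longleftrightarrow>
     comm_family n (\<lambda>i j. x (i, j)) \<and> yb_family n (\<lambda>i j. x (i, j))"
  (is "?L \<longleftrightarrow> ?R")
proof
  assume L: ?L
  show ?R
    unfolding comm_family_def yb_family_def
  proof (intro conjI allI impI)
    fix i j k l assume "{i, j, k, l} \<subseteq> {1..n}" "distinct [i, j, k, l]"
    then have "(lam i j @ lam k l, lam k l @ lam i j) \<in> VP_rels n"
      by (rule VP_rels_comm)
    then show "commutes (x (i, j)) (x (k, l))"
      using L by (force simp: commutes_def)
  next
    fix i j k assume "{i, j, k} \<subseteq> {1..n}" "distinct [i, j, k]"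
    then have "(lam i j @ lam i k @ lam j k, lam j k @ lam i k @ lam i j) \<in> VP_rels n"
      by (intro VP_rels_yang_baxter) auto
    then show "yang_baxter (x (i, j)) (x (i, k)) (x (j, k))"
      using L by (force simp: yang_baxter_def)
  qed
next
  assume ?R
  then show ?L
    unfolding VP_rels_def comm_family_def yb_family_def commutes_def yang_baxter_def by fastforce
qed

text \<open>Substituting words for letters and then taking values amounts to assigning to each letter the
  value of its word, so this is the previous lemma for another family of elements.\<close>

lemma doubled_rels_hold_iff:
  "(\<forall>(u, v) \<in> doubled_rels t n. ev u = ev v) \<longleftrightarrow>
     comm_family n (\<lambda>i j. ev (doubling_gen t (i, j))) \<and>
     yb_family n (\<lambda>i j. ev (doubling_gen t (i, j)))"
proof -
  interpret d: strand_values G "\<lambda>g. ev (doubling_gen t g)"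
    by standard auto
  have "d.ev w = ev (doubling t w)" for w
    by (induction w) (auto simp: doubling_def gword_subst_def)
  then show ?thesis
    using d.VP_rels_hold_iff[of n] by (auto simp: doubled_rels_def)
qed

lemma commutes_ev_concat:
  assumes "\<And>w. w \<in> set ws \<Longrightarrow> commutes y (ev w)" "y \<in> carrier G"
  shows "commutes y (ev (concat ws))"
  using assms(1)
proof (induction ws)
  case Nil
  then show ?case using assms(2) by (simp add: commutes_def)
next
  case (Cons w ws)
  then show ?case using assms(2) by (simp add: commutes_mult)
qed

lemma dbl_other:
  assumes "i \<noteq> p" "j \<noteq> p" "i \<noteq> j" "1 \<le> i" "1 \<le> j" "1 \<le> p"
  shows "dbl p i j = x (shift p i, shift p j)"
proof (cases "i < j")
  case True
  then consider "p < i" | "i < p" "p < j" | "j < p" using assms by linarith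
  then show ?thesis
    using True assms by cases (auto simp: dbl_def doubling_gen_def doubling_pos_def shift_def)
next
  case False
  then consider "p < j" | "j < p" "p < i" | "i < p" using assms by linarith
  then show ?thesis
    using False assms by cases (auto simp: dbl_def doubling_gen_def doubling_neg_def shift_def)
qed

text \<open>For \<open>j < p\<close> the second factor is conjugated by \<open>x (p, 1) \<cdots> x (p, j-1)\<close>, inverted letterwise;
  the hypothesis makes this conjugation trivial.\<close>

lemma dbl_first:
  assumes "j \<noteq> p" "1 \<le> j" "1 \<le> p"
    and c: "\<And>i. 1 \<le> i \<Longrightarrow> i < j \<Longrightarrow> j < p \<Longrightarrow> commutes (x (p, i)) (x (p + 1, j))"
  shows "dbl p p j = x (p, shift p j) \<otimes> x (p + 1, shift p j)"
proof (cases "p < j")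
  case True
  then show ?thesis
    using assms(1-3) by (auto simp: dbl_def doubling_gen_def doubling_pos_def shift_def)
next
  case False
  let ?W = "concat (map (\<lambda>i. gword_inv (lam p i)) [1..<j])"
  have "commutes (x (p + 1, j)) (ev ?W)"
  proof (rule commutes_ev_concat)
    fix w assume "w \<in> set (map (\<lambda>i. gword_inv (lam p i)) [1..<j])"
    then obtain i where w: "w = gword_inv (lam p i)" and i: "1 \<le> i" "i < j" by auto
    have "commutes (x (p + 1, j)) (x (p, i))"
      using i False assms(1) by (intro commutes_sym[OF c]) auto
    then show "commutes (x (p + 1, j)) (ev w)" by (simp add: w commutes_inv)
  qed simp
  then show ?thesis
    using False assms(1-3)
    by (auto simp: dbl_def doubling_gen_def doubling_neg_def shift_def ev_gword_conj commutes_conj)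
qed

lemma dbl_second_conj:
  assumes "1 \<le> i" "i < p"
  shows "dbl p i p = inv ev (concat (map (\<lambda>q. lam q p) [1..<i])) \<otimes> x (i, p + 1) \<otimes>
           ev (concat (map (\<lambda>q. lam q p) [1..<i])) \<otimes> x (i, p)"
  using assms by (auto simp: dbl_def doubling_gen_def doubling_pos_def shift_def ev_gword_conj)

text \<open>As for the first index: the hypothesis makes the conjugation in the case \<open>i < p\<close> trivial.\<close>

lemma dbl_second:
  assumes "i \<noteq> p" "1 \<le> i" "1 \<le> p"
    and c: "\<And>q. 1 \<le> q \<Longrightarrow> q < i \<Longrightarrow> i < p \<Longrightarrow> commutes (x (q, p)) (x (i, p + 1))"
  shows "dbl p i p = x (shift p i, p + 1) \<otimes> x (shift p i, p)"
proof (cases "p < i")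
  case True
  then show ?thesis
    using assms(1-3) by (auto simp: dbl_def doubling_gen_def doubling_neg_def shift_def)
next
  case False
  let ?W = "concat (map (\<lambda>q. lam q p) [1..<i])"
  have "commutes (x (i, p + 1)) (ev ?W)"
  proof (rule commutes_ev_concat)
    fix w assume "w \<in> set (map (\<lambda>q. lam q p) [1..<i])"
    then obtain q where w: "w = lam q p" and q: "1 \<le> q" "q < i" by auto
    have "commutes (x (i, p + 1)) (x (q, p))"
      using q False assms(1) by (intro commutes_sym[OF c]) auto
    then show "commutes (x (i, p + 1)) (ev w)" by (simp add: w)
  qed simp
  then show ?thesis
    using False assms(1-3) dbl_second_conj[of i p] by (simp add: shift_def commutes_conj)
qed

text \<open>A conjugation occurs only for \<open>j < p\<close>, and all indices in it are at most \<open>p + 1\<close>. So relations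
  among \<open>N \<ge> p + 1\<close> strands suffice even if \<open>j\<close> or its shift exceeds \<open>N\<close>; in the sliding arguments
  this allows results about the strand \<open>n + 1\<close> to be drawn from relations among \<open>n\<close> strands.\<close>

lemma dbl_values:
  assumes C: "comm_family N (\<lambda>i j. x (i, j))" and p: "1 \<le> p" "p + 1 \<le> N" and j: "1 \<le> j" "j \<noteq> p"
  shows "dbl p p j = x (p, shift p j) \<otimes> x (p + 1, shift p j)"
    and "dbl p j p = x (shift p j, p + 1) \<otimes> x (shift p j, p)"
proof -
  have c: "commutes (x (p, i)) (x (p + 1, j))" "commutes (x (i, p)) (x (j, p + 1))"
    if "1 \<le> i" "i < j" "j < p" for i
    using that p by (auto intro!: comm_familyD[OF C])
  show "dbl p p j = x (p, shift p j) \<otimes> x (p + 1, shift p j)"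
    by (rule dbl_first[OF j(2,1) p(1) c(1)])
  show "dbl p j p = x (shift p j, p + 1) \<otimes> x (shift p j, p)"
    by (rule dbl_second[OF j(2,1) p(1) c(2)])
qed

section \<open>Doubling preserves the relations\<close>

lemma comm_family_dbl:
  assumes C: "comm_family (n + 1) (\<lambda>i j. x (i, j))" and p: "p \<in> {1..n}"
  shows "comm_family n (dbl p)"
proof -
  have p': "1 \<le> p" "p + 1 \<le> n + 1" using p by auto
  note D = dbl_values[OF C p'] and O = dbl_other[OF _ _ _ _ _ p'(1)] and X = comm_familyD[OF C]
  have *: "commutes (dbl p i j) (dbl p k l)"
    if r: "{i, j, k, l} \<subseteq> {1..n}" and d: "distinct [i, j, k, l]" and ij: "i \<noteq> p" "j \<noteq> p" for i j k l
  proof -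
    have s: "shift p i \<in> {1..n+1}" "shift p j \<in> {1..n+1}" "shift p k \<in> {1..n+1}" "shift p l \<in> {1..n+1}"
      using r shift_range[of _ n p] by auto
    have dij: "dbl p i j = x (shift p i, shift p j)"
      using r d ij by (intro O) auto
    consider "k = p" | "l = p" | "k \<noteq> p" "l \<noteq> p" by blast
    then show ?thesis
    proof cases
      case 1
      have "commutes (dbl p i j) (x (p, shift p l) \<otimes> x (p + 1, shift p l))"
        unfolding dij using 1 ij s p d by (intro commutes_mult X) auto
      then show ?thesis using 1 r d D(1)[of l] by auto
    next
      case 2
      have "commutes (dbl p i j) (x (shift p k, p + 1) \<otimes> x (shift p k, p))"
        unfolding dij using 2 ij s p d by (intro commutes_mult X) auto
      then show ?thesis using 2 r d D(2)[of k] by auto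
    next
      case 3
      have "commutes (dbl p i j) (x (shift p k, shift p l))"
        unfolding dij using s d by (intro X) auto
      then show ?thesis using 3 r d O[of k l] by auto
    qed
  qed
  show ?thesis
    unfolding comm_family_def
  proof (intro allI impI)
    fix i j k l assume r: "{i, j, k, l} \<subseteq> {1..n}" and d: "distinct [i, j, k, l]"
    show "commutes (dbl p i j) (dbl p k l)"
    proof (cases "i = p \<or> j = p")
      case True
      then show ?thesis using r d by (intro commutes_sym[OF *]) auto
    next
      case False
      then show ?thesis using r d by (intro *) auto
    qed
  qed
qed

definition yb :: "nat \<Rightarrow> nat \<Rightarrow> nat \<Rightarrow> bool" where
  "yb i j k \<longleftrightarrow> yang_baxter (x (i, j)) (x (i, k)) (x (j, k))"

text \<open>Stated as an equivalence, the same computation shows that the doubled relations follow from the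
  original ones and that the latter can be transported from the strand \<open>p\<close> to \<open>p + 1\<close>.\<close>

lemma yang_baxter_dbl_iff:
  assumes C: "comm_family (n + 1) (\<lambda>i j. x (i, j))" and p: "p \<in> {1..n}"
    and r: "{j, k} \<subseteq> {1..n}" and d: "distinct [p, j, k]"
  shows "yb p (shift p j) (shift p k) \<Longrightarrow>
           yang_baxter (dbl p p j) (dbl p p k) (dbl p j k) \<longleftrightarrow> yb (p + 1) (shift p j) (shift p k)"
    and "yb (shift p j) p (shift p k) \<Longrightarrow>
           yang_baxter (dbl p j p) (dbl p j k) (dbl p p k) \<longleftrightarrow> yb (shift p j) (p + 1) (shift p k)"
    and "yb (shift p j) (shift p k) p \<Longrightarrow>
           yang_baxter (dbl p j k) (dbl p j p) (dbl p k p) \<longleftrightarrow> yb (shift p j) (shift p k) (p + 1)"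
proof -
  have p': "1 \<le> p" "p + 1 \<le> n + 1" using p by auto
  note D = dbl_values[OF C p'] and O = dbl_other[OF _ _ _ _ _ p'(1)] and X = comm_familyD[OF C]
  have jk: "1 \<le> j" "1 \<le> k" "j \<noteq> p" "k \<noteq> p" "j \<noteq> k" using r d by auto
  have s: "shift p j \<in> {1..n+1}" "shift p k \<in> {1..n+1}"
    using r shift_range[of _ n p] by auto
  show "yang_baxter (dbl p p j) (dbl p p k) (dbl p j k) \<longleftrightarrow> yb (p + 1) (shift p j) (shift p k)"
    if "yb p (shift p j) (shift p k)"
    unfolding D(1)[OF jk(1,3)] D(1)[OF jk(2,4)] O[OF jk(3,4,5,1,2)] yb_def
    using that jk s p by (intro yang_baxter_double_first X) (auto simp: yb_def)
  show "yang_baxter (dbl p j p) (dbl p j k) (dbl p p k) \<longleftrightarrow> yb (shift p j) (p + 1) (shift p k)"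
    if "yb (shift p j) p (shift p k)"
    unfolding D(2)[OF jk(1,3)] D(1)[OF jk(2,4)] O[OF jk(3,4,5,1,2)] yb_def
    using that jk s p by (intro yang_baxter_double_second X) (auto simp: yb_def)
  show "yang_baxter (dbl p j k) (dbl p j p) (dbl p k p) \<longleftrightarrow> yb (shift p j) (shift p k) (p + 1)"
    if "yb (shift p j) (shift p k) p"
    unfolding D(2)[OF jk(1,3)] D(2)[OF jk(2,4)] O[OF jk(3,4,5,1,2)] yb_def
    using that jk s p by (intro yang_baxter_double_third X) (auto simp: yb_def)
qed

lemma yb_family_dbl:
  assumes C: "comm_family (n + 1) (\<lambda>i j. x (i, j))" and Y: "yb_family (n + 1) (\<lambda>i j. x (i, j))"
    and p: "p \<in> {1..n}"
  shows "yb_family n (dbl p)"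
  unfolding yb_family_def
proof (intro allI impI)
  fix i j k assume r: "{i, j, k} \<subseteq> {1..n}" and d: "distinct [i, j, k]"
  note iff = yang_baxter_dbl_iff[OF C p]
  have Y': "yb a b c" if "{a, b, c} \<subseteq> {1..n + 1}" "distinct [a, b, c]" for a b c
    using yb_familyD[OF Y that] by (simp add: yb_def)
  have s: "shift p i \<in> {1..n+1}" "shift p j \<in> {1..n+1}" "shift p k \<in> {1..n+1}"
    using r shift_range[of _ n p] by auto
  consider "i = p" | "j = p" | "k = p" | "i \<noteq> p" "j \<noteq> p" "k \<noteq> p" by blast
  then show "yang_baxter (dbl p i j) (dbl p i k) (dbl p j k)"
  proof cases
    case 1
    have "yb p (shift p j) (shift p k)" "yb (p + 1) (shift p j) (shift p k)"
      using 1 s p d by (auto intro!: Y')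
    moreover have "{j, k} \<subseteq> {1..n}" "distinct [p, j, k]" using 1 d r by auto
    ultimately show ?thesis using 1 iff(1) by metis
  next
    case 2
    have "yb (shift p i) p (shift p k)" "yb (shift p i) (p + 1) (shift p k)"
      using 2 s p d by (auto intro!: Y')
    moreover have "{i, k} \<subseteq> {1..n}" "distinct [p, i, k]" using 2 d r by auto
    ultimately show ?thesis using 2 iff(2) by metis
  next
    case 3
    have "yb (shift p i) (shift p j) p" "yb (shift p i) (shift p j) (p + 1)"
      using 3 s p d by (auto intro!: Y')
    moreover have "{i, j} \<subseteq> {1..n}" "distinct [p, i, j]" using 3 d r by auto
    ultimately show ?thesis using 3 iff(3) by metis
  next
    case 4
    have "yb (shift p i) (shift p j) (shift p k)"
      using s d by (intro Y') auto
    then show ?thesis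
      using 4 r d p by (simp add: dbl_other yb_def)
  qed
qed

section \<open>Recovering the commutation relations\<close>

text \<open>Throughout, the first \<open>n\<close> strands satisfy the commutation relations, and so do the doubled
  generators; wanted are the commutation relations that involve the new last strand.\<close>

definition comm_top :: "nat \<Rightarrow> nat \<Rightarrow> nat \<Rightarrow> nat \<Rightarrow> bool" where
  "comm_top n a k l \<longleftrightarrow> commutes (x (a, n + 1)) (x (k, l))"

text \<open>Double \<open>p < n\<close> in the relation between \<open>\<lambda>\<^bsub>a',n\<^esub>\<close> and \<open>\<lambda>\<^bsub>p,r'\<^esub>\<close>, where \<open>a\<close> and \<open>r\<close> are the
  new numbers of \<open>a'\<close> and \<open>r'\<close>: the strand \<open>n\<close> moves to \<open>n + 1\<close>, so \<open>x (a, n + 1)\<close> commutes with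
  \<open>x (p, r) \<otimes> x (p + 1, r)\<close>, hence with one of the factors if it commutes with the other.\<close>

lemma comm_top_slide:
  assumes C: "comm_family n (\<lambda>i j. x (i, j))" and dC: "comm_family n (dbl p)"
    and p: "1 \<le> p" "p < n" and q: "q = p + 1"
    and r: "{a, r} \<subseteq> {1..n}" and d: "distinct [a, r, p, q]"
  shows "comm_top n a p r \<Longrightarrow> comm_top n a q r"
    and "comm_top n a r p \<Longrightarrow> comm_top n a r q"
proof -
  have ar: "{a, r} \<subseteq> {1..n} - {p, p + 1}" "a \<noteq> r" using r d q by auto
  have p': "p + 1 \<le> n" using p by simp
  obtain a' where a': "a' \<in> {1..n}" "a' \<noteq> p" "a = shift p a'"
    using ar p by (auto intro: shift_surj[of a n p])
  obtain r' where r': "r' \<in> {1..n}" "r' \<noteq> p" "r = shift p r'"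
    using ar p by (auto intro: shift_surj[of r n p])
  have n: "a' \<noteq> n" "r' \<noteq> n" using a'(3) r'(3) ar p by (auto simp: shift_def)
  have top: "shift p n = n + 1" using p by (simp add: shift_def)
  have e: "dbl p a' n = x (a, n + 1)"
    using a' n p top by (simp add: dbl_other)
  have "{a', n, p, r'} \<subseteq> {1..n}" "distinct [a', n, p, r']" "distinct [a', n, r', p]"
    using a' r' n p ar by auto
  then have "commutes (dbl p a' n) (dbl p p r')" "commutes (dbl p a' n) (dbl p r' p)"
    using comm_familyD[OF dC, of a' n p r'] comm_familyD[OF dC, of a' n r' p] by auto
  then have "commutes (x (a, n + 1)) (x (p, r) \<otimes> x (p + 1, r))"
    "commutes (x (a, n + 1)) (x (r, p + 1) \<otimes> x (r, p))"
    unfolding e using dbl_values[OF C p(1) p', of r'] r' by auto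
  then show "comm_top n a p r \<Longrightarrow> comm_top n a q r"
    and "comm_top n a r p \<Longrightarrow> comm_top n a r q"
    by (auto simp: comm_top_def q dest: commutes_factors_iff)
qed

text \<open>The same with the letter \<open>\<lambda>\<^bsub>p,n\<^esub>\<close>, whose double \<open>x (p, n + 1) \<otimes> x (p + 1, n + 1)\<close> contains
  no conjugation because \<open>p < n\<close>.\<close>

lemma comm_top_slide_first:
  assumes C: "comm_family n (\<lambda>i j. x (i, j))" and dC: "comm_family n (dbl p)"
    and p: "1 \<le> p" "p < n" and q: "q = p + 1"
    and r: "{k, l} \<subseteq> {1..n}" and d: "distinct [k, l, p, q]"
  shows "comm_top n p k l \<Longrightarrow> comm_top n q k l"
proof -
  have kl: "{k, l} \<subseteq> {1..n} - {p, p + 1}" "k \<noteq> l" using r d q by auto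
  assume top_p: "comm_top n p k l"
  obtain k' where k': "k' \<in> {1..n}" "k' \<noteq> p" "k = shift p k'"
    using kl p by (auto intro: shift_surj[of k n p])
  obtain l' where l': "l' \<in> {1..n}" "l' \<noteq> p" "l = shift p l'"
    using kl p by (auto intro: shift_surj[of l n p])
  have n: "k' \<noteq> n" "l' \<noteq> n" using k'(3) l'(3) kl p by (auto simp: shift_def)
  have top: "shift p n = n + 1" using p by (simp add: shift_def)
  have e: "dbl p k' l' = x (k, l)"
    using k' l' kl p by (subst dbl_other) auto
  have e': "dbl p p n = x (p, n + 1) \<otimes> x (p + 1, n + 1)"
    using dbl_first[of n p] p top by auto
  have "commutes (dbl p k' l') (dbl p p n)"
    using k' l' n p kl by (intro comm_familyD[OF dC]) auto
  then have "commutes (x (k, l)) (x (p, n + 1) \<otimes> x (p + 1, n + 1))"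
    unfolding e e' .
  then show ?thesis
    using commutes_factors_iff[of "x (k, l)" "x (p, n + 1)" "x (p + 1, n + 1)"]
    using top_p by (auto simp: comm_top_def q intro: commutes_sym)
qed

text \<open>Doubling the last strand turns \<open>\<lambda>\<^bsub>a,n\<^esub>\<close> into \<open>x (a, n + 1) \<otimes> x (a, n)\<close>, with the first factor
  conjugated by \<open>x (1, n) \<cdots> x (a - 1, n)\<close>. Once this conjugation is trivial, the relation with
  \<open>\<lambda>\<^bsub>k,l\<^esub>\<close>, which is unaffected by the doubling, can be read off.\<close>

lemma comm_top_below:
  assumes C: "comm_family n (\<lambda>i j. x (i, j))" and dC: "comm_family n (dbl n)"
    and a: "1 \<le> a" "a < n" and kl: "{k, l} \<subseteq> {1..<n} - {a}" "k \<noteq> l"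
    and c: "\<And>q. 1 \<le> q \<Longrightarrow> q < a \<Longrightarrow> comm_top n a q n"
  shows "comm_top n a k l"
proof -
  have e: "dbl n a n = x (a, n + 1) \<otimes> x (a, n)"
    using a c dbl_second[of a n] by (simp add: comm_top_def commutes_sym shift_def)
  have e': "dbl n k l = x (k, l)"
    using kl a by (subst dbl_other) (auto simp: shift_def)
  have "commutes (dbl n k l) (dbl n a n)"
    using kl a by (intro comm_familyD[OF dC]) auto
  then have "commutes (x (k, l)) (x (a, n + 1) \<otimes> x (a, n))"
    unfolding e e' .
  moreover have "commutes (x (k, l)) (x (a, n))"
    using kl a by (intro comm_familyD[OF C]) auto
  ultimately show ?thesis
    by (auto simp: comm_top_def commutes_mult_right_iff intro: commutes_sym)
qed

text \<open>No letter \<open>x (q, n)\<close> has \<open>q < 1\<close>, so \<open>comm_top_below\<close> gives everything with \<open>k, l < n\<close>. Sliding \<open>n - 1\<close>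
  to \<open>n\<close> then reaches the pairs formed by \<open>n\<close> and some \<open>r \<le> n - 2\<close>, and sliding \<open>n - 2\<close> to
  \<open>n - 1\<close> the pairs formed by \<open>n\<close> and \<open>n - 1\<close>. The strands 1, \<open>n - 2\<close>, \<open>n - 1\<close> and \<open>n\<close> have to
  be distinct here, which is where \<open>n \<ge> 4\<close> enters.\<close>

lemma comm_top_first:
  assumes n: "4 \<le> n" and C: "comm_family n (\<lambda>i j. x (i, j))"
    and dC: "\<And>p. p \<in> {1..n} \<Longrightarrow> comm_family n (dbl p)"
    and kl: "{k, l} \<subseteq> {2..n}" "k \<noteq> l"
  shows "comm_top n 1 k l"
proof -
  note slide = comm_top_slide[OF C dC]
  have below: "comm_top n 1 k l" if "{k, l} \<subseteq> {2..n - 1}" "k \<noteq> l" for k l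
    by (rule comm_top_below[OF C dC]) (use that n in auto)
  have last: "comm_top n 1 r n \<and> comm_top n 1 n r" if r: "r \<in> {2..n - 2}" for r
  proof
    have b: "comm_top n 1 r (n - 1)" "comm_top n 1 (n - 1) r"
      by (rule below; use n r in auto)+
    show "comm_top n 1 r n"
      by (rule slide(2)[OF _ _ _ _ _ _ b(1)]) (use n r in auto)
    show "comm_top n 1 n r"
      by (rule slide(1)[OF _ _ _ _ _ _ b(2)]) (use n r in auto)
  qed
  have "comm_top n 1 (n - 1) n \<and> comm_top n 1 n (n - 1)"
  proof
    have b: "comm_top n 1 (n - 2) n" "comm_top n 1 n (n - 2)"
      using last[of "n - 2"] n by auto
    show "comm_top n 1 (n - 1) n"
      by (rule slide(1)[OF _ _ _ _ _ _ b(1)]) (use n in auto)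
    show "comm_top n 1 n (n - 1)"
      by (rule slide(2)[OF _ _ _ _ _ _ b(2)]) (use n in auto)
  qed
  then have last': "comm_top n 1 r n \<and> comm_top n 1 n r" if r: "r \<in> {2..n - 1}" for r
    using that last[of r] by (cases "r = n - 1") auto
  consider "k = n" "l \<in> {2..n - 1}" | "l = n" "k \<in> {2..n - 1}" | "{k, l} \<subseteq> {2..n - 1}"
    using kl by force
  then show ?thesis
  proof cases
    case 1
    then show ?thesis using last' by simp
  next
    case 2
    then show ?thesis using last' by simp
  next
    case 3
    then show ?thesis by (rule below[OF _ kl(2)])
  qed
qed

text \<open>Two facts about the letter \<open>x (1, n - 1)\<close> are combined: doubling the strand \<open>n\<close> shows that it
  commutes with the conjugate of \<open>x (2, n + 1)\<close> by \<open>x (1, n)\<close>, and doubling the strand \<open>n - 1\<close> that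
  \<open>x (1, n) \<otimes> x (1, n - 1)\<close> commutes with \<open>x (2, n + 1)\<close>. By \<open>commutes_of_conj\<close>, \<open>x (1, n - 1)\<close>
  commutes with \<open>x (2, n + 1)\<close>; sliding \<open>n - 1\<close> to \<open>n\<close> yields \<open>x (1, n)\<close>, so that the
  conjugation by it becomes trivial and \<open>comm_top_below\<close> applies.\<close>

lemma comm_top_second:
  assumes n: "4 \<le> n" and C: "comm_family n (\<lambda>i j. x (i, j))"
    and dC: "\<And>p. p \<in> {1..n} \<Longrightarrow> comm_family n (dbl p)"
    and r: "r \<in> {3..n}"
  shows "comm_top n 2 1 r" "comm_top n 2 r 1"
proof -
  note slide = comm_top_slide[OF C dC]
  define y where "y = inv x (1, n) \<otimes> x (2, n + 1) \<otimes> x (1, n)"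
  have y: "y \<in> carrier G" by (simp add: y_def)
  have e: "dbl n 2 n = y \<otimes> x (2, n)"
    using n dbl_second_conj[of 2 n] by (simp add: y_def numeral_2_eq_2)
  have "commutes (dbl n 1 (n - 1)) (dbl n 2 n)"
    using n by (intro comm_familyD[OF dC]) auto
  moreover have "dbl n 1 (n - 1) = x (1, n - 1)"
    using n by (subst dbl_other) (auto simp: shift_def)
  ultimately have "commutes (x (1, n - 1)) (y \<otimes> x (2, n))"
    by (simp add: e)
  moreover have "commutes (x (1, n - 1)) (x (2, n))"
    using n by (intro comm_familyD[OF C]) auto
  ultimately have c1: "commutes y (x (1, n - 1))"
    using y by (auto simp: commutes_mult_right_iff intro: commutes_sym)
  have "commutes (dbl (n - 1) 2 n) (dbl (n - 1) 1 (n - 1))"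
    using n by (intro comm_familyD[OF dC]) auto
  moreover have "dbl (n - 1) 2 n = x (2, n + 1)"
    using n by (subst dbl_other) (auto simp: shift_def)
  moreover have "dbl (n - 1) 1 (n - 1) = x (1, n) \<otimes> x (1, n - 1)"
    using n dbl_second[of 1 "n - 1"] by (simp add: shift_def)
  ultimately have "commutes (x (2, n + 1)) (x (1, n) \<otimes> x (1, n - 1))"
    by simp
  from commutes_of_conj[OF this c1[unfolded y_def]] have b: "comm_top n 2 1 (n - 1)"
    by (simp add: comm_top_def)
  have last: "comm_top n 2 1 n"
    by (rule slide(2)[OF _ _ _ _ _ _ b]) (use n in auto)
  have below: "comm_top n 2 k l" if "{k, l} \<subseteq> {1..<n} - {2}" "k \<noteq> l" for k l
  proof (rule comm_top_below[OF C dC])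
    show "comm_top n 2 q n" if "1 \<le> q" "q < 2" for q
    proof -
      have "q = 1" using that by simp
      then show ?thesis using last by simp
    qed
  qed (use n that in auto)
  have b': "comm_top n 2 (n - 1) 1"
    by (rule below) (use n in auto)
  have last': "comm_top n 2 n 1"
    by (rule slide(1)[OF _ _ _ _ _ _ b']) (use n in auto)
  have "comm_top n 2 1 r \<and> comm_top n 2 r 1"
  proof (cases "r = n")
    case True
    then show ?thesis using last last' by simp
  next
    case False
    then show ?thesis using r n by (auto intro!: below)
  qed
  then show "comm_top n 2 1 r" "comm_top n 2 r 1" by auto
qed

text \<open>Sliding \<open>a - 1\<close> to \<open>a\<close> leaves the case that \<open>k\<close> or \<open>l\<close> is \<open>a - 1\<close>. For \<open>a \<ge> 3\<close> that index is
  reached by sliding \<open>a - 2\<close> to \<open>a - 1\<close>, unless the other index is \<open>a - 2\<close>. This last pair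
  \<open>a - 2, a - 1\<close> is reached for \<open>a \<ge> 4\<close> by sliding \<open>a - 3\<close> to \<open>a - 2\<close>. For \<open>a = 3\<close> there is no
  strand \<open>a - 3\<close>, but \<open>x (3, n + 1)\<close> is already known to commute with \<open>x (1, n)\<close> and
  \<open>x (2, n)\<close>, so \<open>comm_top_below\<close> applies.\<close>

lemma comm_top_all:
  assumes n: "4 \<le> n" and C: "comm_family n (\<lambda>i j. x (i, j))"
    and dC: "\<And>p. p \<in> {1..n} \<Longrightarrow> comm_family n (dbl p)"
  shows "a \<in> {1..n} \<Longrightarrow> {k, l} \<subseteq> {1..n} - {a} \<Longrightarrow> k \<noteq> l \<Longrightarrow> comm_top n a k l"
proof (induction a arbitrary: k l rule: less_induct)
  case (less a)
  note slide = comm_top_slide[OF C dC]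
  show ?case
  proof (cases "a = 1")
    case True
    have "comm_top n 1 k l"
      using less.prems True by (intro comm_top_first[OF n C dC]) auto
    then show ?thesis using True by simp
  next
    case False
    then have a: "2 \<le> a" "a \<le> n" using less.prems by auto
    have away: "comm_top n a k l" if "{k, l} \<subseteq> {1..n} - {a - 1, a}" "k \<noteq> l" for k l
    proof -
      have "comm_top n (a - 1) k l"
      proof (rule less.IH)
        show "{k, l} \<subseteq> {1..n} - {a - 1}" using that(1) by blast
      qed (use a that(2) in auto)
      then show ?thesis
        by (rule comm_top_slide_first[OF C dC, rotated -1]) (use that a in auto)
    qed
    have *: "comm_top n a (a - 1) r \<and> comm_top n a r (a - 1)" if r: "r \<in> {1..n} - {a - 1, a}" for r
    proof (cases "a = 2")
      case True
      then show ?thesis using comm_top_second[OF n C dC, of r] r by auto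
    next
      case False
      then have a3: "3 \<le> a" using a by simp
      have far: "comm_top n a (a - 1) r \<and> comm_top n a r (a - 1)"
        if r: "r \<in> {1..n}" "r \<noteq> a - 2" "r \<noteq> a - 1" "r \<noteq> a" for r
      proof
        have b: "comm_top n a (a - 2) r" "comm_top n a r (a - 2)"
          by (rule away; use r a a3 in auto)+
        show "comm_top n a (a - 1) r"
          by (rule slide(1)[OF _ _ _ _ _ _ b(1)]) (use r a a3 in auto)
        show "comm_top n a r (a - 1)"
          by (rule slide(2)[OF _ _ _ _ _ _ b(2)]) (use r a a3 in auto)
      qed
      have "comm_top n a (a - 1) (a - 2) \<and> comm_top n a (a - 2) (a - 1)"
      proof (cases "a = 3")
        case True
        have "comm_top n 3 q n" if "1 \<le> q" "q < 3" for q
        proof (cases "q = 1")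
          case q: True
          have "comm_top n a 1 n" by (rule away) (use True n in auto)
          then show ?thesis by (simp add: True q)
        next
          case q: False
          then have "q = 2" using that by simp
          then show ?thesis using far[of n] True n by auto
        qed
        then have "comm_top n 3 k l" if "{k, l} \<subseteq> {1, 2}" "k \<noteq> l" for k l
          by (rule comm_top_below[OF C dC, rotated -1]) (use that n in auto)
        from this[of 1 2] this[of 2 1] show ?thesis using True by simp
      next
        case False
        then have a4: "4 \<le> a" using a3 by simp
        have "comm_top n a (a - 1) (a - 3) \<and> comm_top n a (a - 3) (a - 1)"
          by (rule far) (use a a4 in auto)
        then have b: "comm_top n a (a - 1) (a - 3)" "comm_top n a (a - 3) (a - 1)"
          by auto
        show ?thesis
        proof
          show "comm_top n a (a - 1) (a - 2)"
            by (rule slide(2)[OF _ _ _ _ _ _ b(1)]) (use a a4 in auto)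
          show "comm_top n a (a - 2) (a - 1)"
            by (rule slide(1)[OF _ _ _ _ _ _ b(2)]) (use a a4 in auto)
        qed
      qed
      then show ?thesis using far[of r] r by (cases "r = a - 2") auto
    qed
    consider "k = a - 1" "l \<in> {1..n} - {a - 1, a}" | "l = a - 1" "k \<in> {1..n} - {a - 1, a}"
      | "{k, l} \<subseteq> {1..n} - {a - 1, a}"
      using less.prems by auto
    then show ?thesis
      using * away less.prems(3) by cases auto
  qed
qed

lemma comm_family_extend:
  assumes C: "comm_family n (\<lambda>i j. x (i, j))"
    and out: "\<And>a k l. {a, k, l} \<subseteq> {1..n} \<Longrightarrow> distinct [a, k, l] \<Longrightarrow>
      commutes (x (a, n + 1)) (x (k, l))"
    and into: "\<And>a k l. {a, k, l} \<subseteq> {1..n} \<Longrightarrow> distinct [a, k, l] \<Longrightarrow>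
      commutes (x (n + 1, a)) (x (k, l))"
  shows "comm_family (n + 1) (\<lambda>i j. x (i, j))"
  unfolding comm_family_def
proof (intro allI impI)
  fix i j k l assume r: "{i, j, k, l} \<subseteq> {1..n + 1}" and d: "distinct [i, j, k, l]"
  consider "i = n + 1" | "j = n + 1" | "k = n + 1" | "l = n + 1" | "{i, j, k, l} \<subseteq> {1..n}"
    using r by force
  then show "commutes (x (i, j)) (x (k, l))"
  proof cases
    case 1
    show ?thesis unfolding 1 by (rule into) (use 1 r d in auto)
  next
    case 2
    show ?thesis unfolding 2 by (rule out) (use 2 r d in auto)
  next
    case 3
    show ?thesis unfolding 3 by (rule commutes_sym[OF into]) (use 3 r d in auto)
  next
    case 4
    show ?thesis unfolding 4 by (rule commutes_sym[OF out]) (use 4 r d in auto)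
  next
    case 5
    then show ?thesis using d by (rule comm_familyD[OF C])
  qed
qed

section \<open>Recovering the Yang--Baxter relations\<close>

text \<open>All orders of the three strands at once: then only the set of strands matters when an index
  is moved.\<close>

definition yb_all :: "nat \<Rightarrow> nat \<Rightarrow> nat \<Rightarrow> bool" where
  "yb_all a b c \<longleftrightarrow> yb a b c \<and> yb a c b \<and> yb b a c \<and> yb b c a \<and> yb c a b \<and> yb c b a"

lemma yb_all_commute: "yb_all a b c \<Longrightarrow> yb_all b a c" "yb_all a b c \<Longrightarrow> yb_all a c b"
  by (auto simp: yb_all_def)

lemma yb_all_slide:
  assumes C: "comm_family (n + 1) (\<lambda>i j. x (i, j))" and dY: "yb_family n (dbl p)"
    and p: "p \<in> {1..n}" and q: "q = p + 1"
    and r: "{b, c} \<subseteq> {1..n + 1}" and d: "distinct [b, c, p, q]"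
    and Y: "yb_all p b c"
  shows "yb_all q b c"
proof -
  have bc: "{b, c} \<subseteq> {1..n + 1} - {p, p + 1}" "b \<noteq> c" using r d q by auto
  obtain b' where b': "b' \<in> {1..n}" "b' \<noteq> p" "b = shift p b'"
    using bc p by (auto intro: shift_surj[of b n p])
  obtain c' where c': "c' \<in> {1..n}" "c' \<noteq> p" "c = shift p c'"
    using bc p by (auto intro: shift_surj[of c n p])
  have bc': "{b', c'} \<subseteq> {1..n}" "distinct [p, b', c']" "{c', b'} \<subseteq> {1..n}" "distinct [p, c', b']"
    using b' c' bc by auto
  have *: "yang_baxter (dbl p i j) (dbl p i k) (dbl p j k)"
    if "{i, j, k} = {p, b', c'}" "distinct [i, j, k]" for i j k
  proof (rule yb_familyD[OF dY])
    show "{i, j, k} \<subseteq> {1..n}" unfolding that(1) using b' c' p by simp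
  qed (rule that(2))
  note iff = yang_baxter_dbl_iff[OF C p]
  have "yb (p + 1) b c" "yb b (p + 1) c" "yb b c (p + 1)"
    using iff[OF bc'(1,2)] *[of p b' c'] *[of b' p c'] *[of b' c' p] Y bc'
    by (auto simp: yb_all_def b'(3) c'(3) insert_commute)
  moreover have "yb (p + 1) c b" "yb c (p + 1) b" "yb c b (p + 1)"
    using iff[OF bc'(3,4)] *[of p c' b'] *[of c' p b'] *[of c' b' p] Y bc'
    by (auto simp: yb_all_def b'(3) c'(3) insert_commute)
  ultimately show ?thesis
    by (simp add: yb_all_def q)
qed

text \<open>Sliding \<open>n\<close> to \<open>n + 1\<close> takes the triples \<open>{n, a, b}\<close> to \<open>{n + 1, a, b}\<close> with \<open>a, b < n\<close>;
  sliding \<open>n - 1\<close> to \<open>n\<close> then gives \<open>{n, a, n + 1}\<close> with \<open>a \<le> n - 2\<close>, and sliding \<open>n - 2\<close> to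
  \<open>n - 1\<close> the remaining triple \<open>{n - 1, n, n + 1}\<close>.\<close>

lemma yb_family_all:
  assumes n: "4 \<le> n" and C: "comm_family (n + 1) (\<lambda>i j. x (i, j))"
    and Y: "yb_family n (\<lambda>i j. x (i, j))" and dY: "\<And>p. p \<in> {1..n} \<Longrightarrow> yb_family n (dbl p)"
  shows "yb_family (n + 1) (\<lambda>i j. x (i, j))"
proof -
  note slide = yb_all_slide[OF C dY]
  have low: "yb_all a b c" if "{a, b, c} \<subseteq> {1..n}" "distinct [a, b, c]" for a b c
    using that yb_familyD[OF Y] by (simp add: yb_all_def yb_def)
  have far: "yb_all (n + 1) a b" if "{a, b} \<subseteq> {1..n - 1}" "a \<noteq> b" for a b
  proof -
    have "yb_all n a b" using that n by (intro low) auto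
    then show ?thesis by (rule slide[rotated -1]) (use that n in auto)
  qed
  have near: "yb_all n a (n + 1)" if a: "a \<in> {1..n - 2}" for a
  proof -
    have "yb_all (n + 1) (n - 1) a" using a n by (intro far) auto
    then have "yb_all (n - 1) a (n + 1)" by (blast intro: yb_all_commute)
    then show ?thesis by (rule slide[rotated -1]) (use a n in auto)
  qed
  have nearest: "yb_all (n - 1) n (n + 1)"
  proof -
    have "yb_all n (n - 2) (n + 1)" using n by (intro near) auto
    then have "yb_all (n - 2) n (n + 1)" by (rule yb_all_commute)
    then show ?thesis by (rule slide[rotated -1]) (use n in auto)
  qed
  have top: "yb_all a b (n + 1)" if ab: "a \<in> {1..n}" "b \<in> {1..n}" "a < b" for a b
  proof -
    consider "b < n" | "b = n" "a < n - 1" | "b = n" "a = n - 1" using ab by force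
    then show ?thesis
    proof cases
      case 1
      then have "yb_all (n + 1) a b" using ab by (intro far) auto
      then show ?thesis by (blast intro: yb_all_commute)
    next
      case 2
      then have "yb_all n a (n + 1)" using ab by (intro near) auto
      then show ?thesis using 2 by (blast intro: yb_all_commute)
    next
      case 3
      then show ?thesis using nearest by simp
    qed
  qed
  have top': "yb_all a b (n + 1)" if ab: "{a, b} \<subseteq> {1..n}" "a \<noteq> b" for a b
    using ab top[of a b] top[of b a] by (cases "a < b") (auto intro: yb_all_commute)
  show ?thesis
    unfolding yb_family_def
  proof (intro allI impI)
    fix i j k assume r: "{i, j, k} \<subseteq> {1..n + 1}" and d: "distinct [i, j, k]"
    consider "i = n + 1" | "j = n + 1" | "k = n + 1" | "{i, j, k} \<subseteq> {1..n}" using r by force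
    then have "yb_all i j k"
    proof cases
      case 1
      then have "yb_all j k (n + 1)" using r d by (intro top') auto
      then show ?thesis using 1 by (blast intro: yb_all_commute)
    next
      case 2
      then have "yb_all i k (n + 1)" using r d by (intro top') auto
      then show ?thesis using 2 by (blast intro: yb_all_commute)
    next
      case 3
      then show ?thesis using r d top'[of i j] by auto
    next
      case 4
      then show ?thesis using d by (intro low)
    qed
    then show "yang_baxter (x (i, j)) (x (i, k)) (x (j, k))"
      by (simp add: yb_all_def yb_def)
  qed
qed

end


section \<open>Reversing words and transposing indices\<close>

text \<open>The signs are kept: on the free group this is the anti-automorphism that exchanges
  \<open>\<lambda>\<^bsub>i,j\<^esub>\<close> and \<open>\<lambda>\<^bsub>j,i\<^esub>\<close>.\<close>

definition mirror :: "(nat \<times> nat) gword \<Rightarrow> (nat \<times> nat) gword" where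
  "mirror w = rev (map (\<lambda>((i, j), b). ((j, i), b)) w)"

lemma mirror_append: "mirror (u @ v) = mirror v @ mirror u"
  by (simp add: mirror_def)

lemma mirror_lam: "mirror (lam i j) = lam j i"
  by (simp add: mirror_def lam_def)

lemma mirror_gword_inv: "mirror (gword_inv w) = gword_inv (mirror w)"
  by (simp add: mirror_def gword_inv_def rev_map o_def case_prod_unfold)

lemma mirror_concat: "mirror (concat ws) = concat (map mirror (rev ws))"
  by (induction ws) (auto simp: mirror_append, simp add: mirror_def)

lemma gword_inv_concat: "gword_inv (concat ws) = concat (map gword_inv (rev ws))"
  by (induction ws) (auto simp: gword_inv_append, simp add: gword_inv_def)

text \<open>Conjugation by \<open>w\<close> becomes conjugation by the inverse of \<open>mirror w\<close>, which accounts for the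
  inverted letters in the words for \<open>\<lambda>\<^bsub>l,k\<^esub>\<close>.\<close>

lemma mirror_doubling_pos: "mirror (doubling_pos t k l) = doubling_neg t k l"
  by (simp add: doubling_pos_def doubling_neg_def gword_conj_def mirror_append mirror_lam
      mirror_gword_inv mirror_concat gword_inv_concat rev_map o_def)

lemma mirror_mirror: "mirror (mirror w) = w"
  by (simp add: mirror_def rev_map o_def case_prod_unfold)

lemma mirror_doubling_neg: "mirror (doubling_neg t k l) = doubling_pos t k l"
  by (simp flip: mirror_doubling_pos add: mirror_mirror)

lemma mirror_doubling_gen: "i \<noteq> j \<Longrightarrow> mirror (doubling_gen t (i, j)) = doubling_gen t (j, i)"
  by (auto simp: doubling_gen_def mirror_doubling_pos mirror_doubling_neg)

lemma doubling_append: "doubling t (u @ v) = doubling t u @ doubling t v"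
  by (simp add: doubling_def gword_subst_def)

lemma doubling_lam: "doubling t (lam i j) = doubling_gen t (i, j)"
  by (simp add: doubling_def gword_subst_def lam_def)

lemma mirror_VP_rels: "(u, v) \<in> VP_rels n \<Longrightarrow> (mirror u, mirror v) \<in> VP_rels n"
proof -
  assume "(u, v) \<in> VP_rels n"
  then show ?thesis
  proof (cases rule: VP_rels_cases)
    case (comm i j k l)
    have "(lam l k @ lam j i, lam j i @ lam l k) \<in> VP_rels n"
      by (rule VP_rels_comm) (use comm in auto)
    then show ?thesis by (simp add: comm mirror_append mirror_lam)
  next
    case (yb i j k)
    have "(lam j i @ lam j k @ lam i k, lam i k @ lam j k @ lam j i) \<in> VP_rels n"
      by (rule VP_rels_yang_baxter) (use yb in auto)
    then show ?thesis by (simp add: yb mirror_append mirror_lam)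
  qed
qed

lemma mirror_doubling_VP_rels:
  assumes "(u, v) \<in> VP_rels n"
  shows "doubling t (mirror u) = mirror (doubling t u)" "doubling t (mirror v) = mirror (doubling t v)"
proof -
  note simps = mirror_append mirror_lam doubling_append doubling_lam mirror_doubling_gen
  from assms have "doubling t (mirror u) = mirror (doubling t u) \<and>
    doubling t (mirror v) = mirror (doubling t v)"
  proof (cases rule: VP_rels_cases)
    case (comm i j k l)
    have "i \<noteq> j" "k \<noteq> l" using comm(4) by auto
    then show ?thesis by (simp add: comm(1,2) simps)
  next
    case (yb i j k)
    have "i \<noteq> j" "k \<noteq> i" "k \<noteq> j" using yb(4) by auto
    then show ?thesis by (simp add: yb(1,2) simps)
  qed
  then show "doubling t (mirror u) = mirror (doubling t u)"
    "doubling t (mirror v) = mirror (doubling t v)" by auto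
qed

lemma mirror_doubled_rels:
  assumes "(u, v) \<in> doubled_rels t n"
  shows "(mirror u, mirror v) \<in> doubled_rels t n"
proof -
  obtain u' v' where r: "(u', v') \<in> VP_rels n" and uv: "u = doubling t u'" "v = doubling t v'"
    using assms by (auto simp: doubled_rels_def)
  show ?thesis
    unfolding doubled_rels_def
    by (rule image_eqI[OF _ mirror_VP_rels[OF r]]) (simp add: uv mirror_doubling_VP_rels[OF r])
qed

lemma mirror_in_gwords: "w \<in> gwords (VP_gens m) \<Longrightarrow> mirror w \<in> gwords (VP_gens m)"
  by (fastforce simp: mirror_def gwords_def lists_eq_set VP_gens_def)

lemma pres_cong_mirror:
  assumes R: "\<And>u v. (u, v) \<in> R \<Longrightarrow> (mirror u, mirror v) \<in> R"
    and "(u, v) \<in> pres_cong (VP_gens m) R"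
  shows "(mirror u, mirror v) \<in> pres_cong (VP_gens m) R"
  using assms(2)
proof induction
  case (rel u v)
  then show ?case by (intro pres_cong.rel R mirror_in_gwords)
next
  case (cancel x b)
  obtain i j where x: "x = (i, j)" by (cases x)
  have "(j, i) \<in> VP_gens m" using cancel by (auto simp: x VP_gens_def)
  then have "([((j, i), \<not> b), ((j, i), \<not> \<not> b)], []) \<in> pres_cong (VP_gens m) R"
    by (rule pres_cong.cancel)
  then show ?case by (simp add: mirror_def x)
next
  case (append u v u' v')
  then show ?case by (auto simp: mirror_append intro: pres_cong.append)
qed (auto intro: pres_cong.refl mirror_in_gwords pres_cong.sym pres_cong.trans)

section \<open>The presentation of the virtual pure braid group\<close>

lemma lam_in_gwords: "lam i j \<in> gwords X \<longleftrightarrow> (i, j) \<in> X"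
  by (simp add: lam_def)

lemma concat_in_gwords: "concat ws \<in> gwords X \<longleftrightarrow> (\<forall>w\<in>set ws. w \<in> gwords X)"
  by (induction ws) auto

lemma doubling_gen_in_gwords:
  assumes "(i, j) \<in> VP_gens n"
  shows "doubling_gen t (i, j) \<in> gwords (VP_gens (n + 1))"
proof -
  have pos: "doubling_pos t k l \<in> gwords (VP_gens (n + 1))" if "1 \<le> k" "k < l" "l \<le> n" for k l
    using that
    by (auto simp: doubling_pos_def gword_conj_def concat_in_gwords lam_in_gwords VP_gens_def)
  then have "doubling_neg t k l \<in> gwords (VP_gens (n + 1))" if "1 \<le> k" "k < l" "l \<le> n" for k l
    using that mirror_in_gwords mirror_doubling_pos by metis
  with pos show ?thesis
    using assms by (auto simp: doubling_gen_def VP_gens_def)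
qed

lemma VP_rels_mono: "m \<le> n \<Longrightarrow> VP_rels m \<subseteq> VP_rels n"
  by (rule subrelI, erule VP_rels_cases) (auto intro!: VP_rels_comm VP_rels_yang_baxter)

lemma VP_rels_in_gwords: "VP_rels m \<subseteq> gwords (VP_gens m) \<times> gwords (VP_gens m)"
  by (auto simp: VP_rels_def lam_in_gwords VP_gens_def)

lemma doubled_rels_in_gwords:
  "doubled_rels t n \<subseteq> gwords (VP_gens (n + 1)) \<times> gwords (VP_gens (n + 1))"
proof -
  have "doubling t w \<in> gwords (VP_gens (n + 1))" if "w \<in> gwords (VP_gens n)" for w
    using that
    by (induction w) (auto simp: doubling_def gword_subst_def intro: doubling_gen_in_gwords[unfolded Suc_eq_plus1[symmetric]])
  then show ?thesis
    using VP_rels_in_gwords[of n] by (auto simp: doubled_rels_def)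
qed

lemma strand_values_presented_group: "strand_values (presented_group X R) (gen_value X R)"
  unfolding strand_values_def by (rule word_values_presented_group)

lemma doubled_rels_subset_pres_cong:
  assumes p: "p \<in> {1..n}"
  shows "doubled_rels (p - 1) n \<subseteq> pres_cong (VP_gens (n + 1)) (VP_rels (n + 1))"
proof -
  let ?X = "VP_gens (n + 1)" and ?R = "VP_rels (n + 1)"
  interpret strand_values "presented_group ?X ?R" "gen_value ?X ?R"
    by (rule strand_values_presented_group)
  have "\<forall>(u, v) \<in> ?R. ev u = ev v"
    unfolding presented_group_holds_iff[OF VP_rels_in_gwords]
    by (rule rels_subset_pres_cong[OF VP_rels_in_gwords])
  then have C: "comm_family (n + 1) (\<lambda>i j. gen_value ?X ?R (i, j))"
    and Y: "yb_family (n + 1) (\<lambda>i j. gen_value ?X ?R (i, j))"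
    unfolding VP_rels_hold_iff by auto
  have "\<forall>(u, v) \<in> doubled_rels (p - 1) n. ev u = ev v"
    unfolding doubled_rels_hold_iff
    using comm_family_dbl[OF C p] yb_family_dbl[OF C Y p] unfolding dbl_def[abs_def] by (rule conjI)
  then show ?thesis
    unfolding presented_group_holds_iff[OF doubled_rels_in_gwords] .
qed

text \<open>The symmetry of \<open>S\<close> supplies the commutation relations of the letters \<open>\<lambda>\<^bsub>n+1,a\<^esub>\<close> from those of
  the letters \<open>\<lambda>\<^bsub>a,n+1\<^esub>\<close>.\<close>

lemma VP_rels_subset_pres_cong:
  assumes n: "4 \<le> n" and S: "S \<subseteq> gwords (VP_gens (n + 1)) \<times> gwords (VP_gens (n + 1))"
    and low: "VP_rels n \<subseteq> S" and doubled: "\<And>p. p \<in> {1..n} \<Longrightarrow> doubled_rels (p - 1) n \<subseteq> S"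
    and mirror_S: "\<And>u v. (u, v) \<in> S \<Longrightarrow> (mirror u, mirror v) \<in> S"
  shows "VP_rels (n + 1) \<subseteq> pres_cong (VP_gens (n + 1)) S"
proof -
  let ?X = "VP_gens (n + 1)"
  interpret strand_values "presented_group ?X S" "gen_value ?X S"
    by (rule strand_values_presented_group)
  let ?x = "\<lambda>i j. gen_value ?X S (i, j)"
  have holds: "\<forall>(u, v) \<in> S. ev u = ev v"
    unfolding presented_group_holds_iff[OF S] by (rule rels_subset_pres_cong[OF S])
  then have "\<forall>(u, v) \<in> VP_rels n. ev u = ev v"
    using low by blast
  then have C: "comm_family n ?x" and Y: "yb_family n ?x"
    unfolding VP_rels_hold_iff by auto
  have dbl: "comm_family n (dbl p)" "yb_family n (dbl p)" if "p \<in> {1..n}" for p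
  proof -
    have "\<forall>(u, v) \<in> doubled_rels (p - 1) n. ev u = ev v"
      using holds doubled[OF that] by blast
    then show "comm_family n (dbl p)" "yb_family n (dbl p)"
      unfolding doubled_rels_hold_iff dbl_def[abs_def] by auto
  qed
  have comm_iff: "commutes (?x i j) (?x k l) \<longleftrightarrow>
      (lam i j @ lam k l, lam k l @ lam i j) \<in> pres_cong ?X S"
    if "{i, j, k, l} \<subseteq> {1..n + 1}" "distinct [i, j, k, l]" for i j k l
  proof -
    have "{(lam i j @ lam k l, lam k l @ lam i j)} \<subseteq> gwords ?X \<times> gwords ?X"
      using that by (auto simp: lam_in_gwords VP_gens_def)
    from presented_group_holds_iff[OF this, of S] show ?thesis
      by (simp only: commutes_def ev_append ev_lam ball_simps prod.case insert_subset
          empty_subsetI simp_thms)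
  qed
  have top: "commutes (?x a (n + 1)) (?x k l)" if "{a, k, l} \<subseteq> {1..n}" "distinct [a, k, l]" for a k l
    using comm_top_all[OF n C dbl(1), of a k l] that unfolding comm_top_def by auto
  have top_mirror: "commutes (?x (n + 1) a) (?x k l)"
    if r: "{a, k, l} \<subseteq> {1..n}" "distinct [a, k, l]" for a k l
  proof -
    have i: "{a, n + 1, l, k} \<subseteq> {1..n + 1}" "distinct [a, n + 1, l, k]"
      "{k, l, n + 1, a} \<subseteq> {1..n + 1}" "distinct [k, l, n + 1, a]"
      using r by auto
    have "commutes (?x a (n + 1)) (?x l k)"
      using r by (intro top) auto
    then have "(lam a (n + 1) @ lam l k, lam l k @ lam a (n + 1)) \<in> pres_cong ?X S"
      unfolding comm_iff[OF i(1,2)] .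
    then have "(mirror (lam a (n + 1) @ lam l k), mirror (lam l k @ lam a (n + 1))) \<in> pres_cong ?X S"
      by (rule pres_cong_mirror[rotated]) (rule mirror_S)
    then have "commutes (?x k l) (?x (n + 1) a)"
      unfolding comm_iff[OF i(3,4)] mirror_append mirror_lam .
    then show ?thesis by (rule commutes_sym)
  qed
  have C': "comm_family (n + 1) ?x"
    by (rule comm_family_extend[OF C top top_mirror])
  have "\<forall>(u, v) \<in> VP_rels (n + 1). ev u = ev v"
    unfolding VP_rels_hold_iff using C' yb_family_all[OF n C' Y dbl(2)] by (rule conjI)
  then show ?thesis
    unfolding presented_group_holds_iff[OF VP_rels_in_gwords] .
qed

theorem theorem3p3:
  fixes n :: nat
  assumes "n \<ge> 4"
  shows "full_defining_relations (VP (n + 1)) (VP_gens (n + 1)) (VP_gen (n + 1))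
           (VP_rels n \<union> (\<Union>t\<in>{0..n-1}. doubled_rels t n))"
proof -
  let ?X = "VP_gens (n + 1)" and ?R = "VP_rels (n + 1)"
  let ?S = "VP_rels n \<union> (\<Union>t\<in>{0..n-1}. doubled_rels t n)"
  have low: "VP_rels n \<subseteq> ?R"
    by (rule VP_rels_mono) simp
  have S: "?S \<subseteq> gwords ?X \<times> gwords ?X"
    by (intro Un_least UN_least order_trans[OF low VP_rels_in_gwords] doubled_rels_in_gwords)
  have doubled: "doubled_rels t n \<subseteq> pres_cong ?X ?R" if "t \<in> {0..n-1}" for t
    using doubled_rels_subset_pres_cong[of "t + 1" n] that assms by simp
  have "?S \<subseteq> pres_cong ?X ?R"
    by (intro Un_least UN_least doubled
        order_trans[OF low rels_subset_pres_cong[OF VP_rels_in_gwords]])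
  moreover have "?R \<subseteq> pres_cong ?X ?S"
  proof (rule VP_rels_subset_pres_cong[OF assms S])
    show "doubled_rels (p - 1) n \<subseteq> ?S" if "p \<in> {1..n}" for p
    proof -
      have "p - 1 \<in> {0..n-1}" using that by auto
      then show ?thesis by blast
    qed
    show "(mirror u, mirror v) \<in> ?S" if "(u, v) \<in> ?S" for u v
      using that by (elim UnE UN_E) (intro UnI1 UnI2 UN_I mirror_VP_rels mirror_doubled_rels; assumption)+
  qed (rule Un_upper1)
  ultimately have "full_defining_relations (presented_group ?X ?R) ?X
      (\<lambda>g. pres_class ?X ?R [(g, True)]) ?S"
    by (rule full_defining_relations_presented_group)
  then show ?thesis
    unfolding VP_def VP_gen_def[abs_def] .
qed

end
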